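(* Let $\omega>\omega_0\ge 0$ and let $\phi_0\in\mathcal N_\omega$. Let $\phi(t)=\phi(\cdot,t)$, $0\le t\le T$, be a solution of the continuous normalized gradient flow $$\partial_t\phi=\Delta\phi-V\phi-\omega\phi+|\phi|^{2\alpha}\phi+\mu_\phi(t)\,\phi,\qquad \phi(\cdot,0)=\phi_0,$$ where $$\mu_\phi(t)=-\frac{\|H_\omega\phi(\cdot,t)\|_{L^2}^2-(\alpha+2)\langle H_\omega\phi(\cdot,t),|\phi(\cdot,t)|^{2\alpha}\phi(\cdot,t)\rangle+(\alpha+1)\|\phi(\cdot,t)\|_{L^{4\alpha+2}}^{4\alpha+2}}{\alpha\,\|\phi(\cdot,t)\|_{L^{2\alpha+2}}^{2\alpha+2}}.$$ Then the flow preserves $I_\omega=0$, i.e. $I_\omega(\phi(t))=0$ for all $t\in[0,T]$, and it diminishes the action, i.e. $S_\omega(\phi(t'))\le S_\omega(\phi(t))$ for all $0\le t\le t'\le T$.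
   Context: Let $d\ge 1$ be the dimension and let $0<\alpha<\frac{2}{(d-2)_+}$, where $(d-2)_+=\max\{0,d-2\}$ (so $\alpha>0$ is arbitrary for $d\le 2$). All norms, spaces and integrals are over $\mathbb R^d$; $\langle\cdot,\cdot\rangle$ is the $L^2$ inner product. The functions $\phi_0$ and $\phi$ are real-valued. Assumptions on the real-valued potential $V$: (i) $V\in L^q(\mathbb R^d)+L^\infty(\mathbb R^d)$, where $q=1$ if $d=1$, $q>1$ if $d=2$, and $q=d/2$ if $d\ge 3$; when $d=1$, $V$ may also be the sum of a bounded Borel measure and an $L^\infty$ function that vanishes at infinity. (ii) $V$ vanishes at infinity: $|\{x\in\mathbb R^d:|V(x)|>a\}|<\infty$ for all $a>0$. (iii) $V$ is non-positive in the sense that the potential energy $\int V|\psi|^2\,dx$ is non-positive for all $\psi\in H^1$. Definitions: $H_\omega\phi=-\Delta\phi+V\phi+\omega\phi$ (Schrödinger operator); $\omega_0=-\inf\{\int(|\nabla\phi|^2+V|\phi|^2)\,dx:\phi\in H^1,\ \|\phi\|_{L^2}=1\}$; $S_\omega(\phi)=\int\big(|\nabla\phi|^2+V|\phi|^2+\omega|\phi|^2-\frac{1}{\alpha+1}|\phi|^{2\alpha+2}\big)dx$ (action functional); $I_\omega(\phi)=\int\big(|\nabla\phi|^2+V|\phi|^2+\omega|\phi|^2-|\phi|^{2\alpha+2}\big)dx$ (Nehari functional); $\mathcal N_\omega=\{0\ne\phi\in H^1: I_\omega(\phi)=0\}$ (Nehari manifold). *)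

theory Defs
  imports "HOL-Analysis.Analysis"
begin

text \<open>
  Throughout, the type \<open>'a :: euclidean_space\<close> plays the role of $R^d$ with \<open>d = DIM('a)\<close>.
  Elements of Lebesgue and Sobolev spaces are represented by real-valued Borel functions;
  equality in these spaces is equality almost everywhere.
\<close>

definition Lp :: "real \<Rightarrow> ('a::euclidean_space \<Rightarrow> real) set" where
  "Lp p = {f \<in> borel_measurable lborel. integrable lborel (\<lambda>x. \<bar>f x\<bar> powr p)}"

definition Linf :: "('a::euclidean_space \<Rightarrow> real) set" where
  "Linf = {f \<in> borel_measurable lborel. \<exists>C. AE x in lborel. \<bar>f x\<bar> \<le> C}"

definition lp_norm :: "real \<Rightarrow> ('a::euclidean_space \<Rightarrow> real) \<Rightarrow> real" where
  "lp_norm p f = (LINT x|lborel. \<bar>f x\<bar> powr p) powr (1 / p)"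

definition l2_inner :: "('a::euclidean_space \<Rightarrow> real) \<Rightarrow> ('a \<Rightarrow> real) \<Rightarrow> real" where
  "l2_inner f g = (LINT x|lborel. f x * g x)"

definition lp_continuous_on ::
    "real \<Rightarrow> real set \<Rightarrow> (real \<Rightarrow> 'a::euclidean_space \<Rightarrow> real) \<Rightarrow> bool" where
  "lp_continuous_on p J u \<longleftrightarrow> (\<forall>t\<in>J. u t \<in> Lp p) \<and>
     (\<forall>t\<in>J. ((\<lambda>s. lp_norm p (\<lambda>x. u s x - u t x)) \<longlongrightarrow> 0) (at t within J))"

definition l2_has_time_derivative ::
    "(real \<Rightarrow> 'a::euclidean_space \<Rightarrow> real) \<Rightarrow> ('a \<Rightarrow> real) \<Rightarrow> real \<Rightarrow> real set \<Rightarrow> bool" where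
  "l2_has_time_derivative u f t J \<longleftrightarrow>
     ((\<lambda>s. lp_norm 2 (\<lambda>x. (u s x - u t x) / (s - t) - f x)) \<longlongrightarrow> 0) (at t within J)"


subsection \<open>The Sobolev space $H^1$\<close>

primrec times_cont_diff :: "nat \<Rightarrow> ('a::euclidean_space \<Rightarrow> real) \<Rightarrow> bool" where
  "times_cont_diff 0 f \<longleftrightarrow> continuous_on UNIV f"
| "times_cont_diff (Suc k) f \<longleftrightarrow> (\<forall>x. f differentiable (at x)) \<and>
     (\<forall>i\<in>Basis. times_cont_diff k (\<lambda>x. frechet_derivative f (at x) i))"

definition test_functions :: "('a::euclidean_space \<Rightarrow> real) set" where
  "test_functions = {f. (\<forall>k. times_cont_diff k f) \<and> compact (closure {x. f x \<noteq> 0})}"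

definition has_L2_weak_gradient :: "('a::euclidean_space \<Rightarrow> real) \<Rightarrow> ('a \<Rightarrow> 'a) \<Rightarrow> bool" where
  "has_L2_weak_gradient f G \<longleftrightarrow>
     G \<in> borel_measurable lborel \<and> integrable lborel (\<lambda>x. (norm (G x))\<^sup>2) \<and>
     (\<forall>\<eta>\<in>test_functions. \<forall>i\<in>Basis.
        (LINT x|lborel. f x * frechet_derivative \<eta> (at x) i) =
        - (LINT x|lborel. (G x \<bullet> i) * \<eta> x))"

definition H1 :: "('a::euclidean_space \<Rightarrow> real) set" where
  "H1 = {f \<in> Lp 2. \<exists>G. has_L2_weak_gradient f G}"

definition weak_gradient :: "('a::euclidean_space \<Rightarrow> real) \<Rightarrow> 'a \<Rightarrow> 'a" where
  "weak_gradient f = (SOME G. has_L2_weak_gradient f G)"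

text \<open>Used only in dimension one, where every element of $H^1$ has a unique continuous
  representative; this is the version that is integrated against a measure.\<close>

definition cont_rep :: "('a::euclidean_space \<Rightarrow> real) \<Rightarrow> 'a \<Rightarrow> real" where
  "cont_rep f = (SOME g. continuous_on UNIV g \<and> (AE x in lborel. g x = f x))"


subsection \<open>Potentials\<close>

text \<open>\<open>Measure_potential m n w\<close> stands for the potential $m - n + w$: a bounded signed Borel
  measure, written as the difference of two finite positive ones, plus a function.\<close>

datatype 'a potential =
  Function_potential "'a \<Rightarrow> real"
| Measure_potential "'a measure" "'a measure" "'a \<Rightarrow> real"

definition vanishes_at_infinity :: "('a::euclidean_space \<Rightarrow> real) \<Rightarrow> bool" where
  "vanishes_at_infinity v \<longleftrightarrow> (\<forall>a>0. emeasure lborel {x. \<bar>v x\<bar> > a} < \<infinity>)"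

definition admissible_exponent :: "nat \<Rightarrow> real \<Rightarrow> bool" where
  "admissible_exponent d q \<longleftrightarrow>
     (d = 1 \<and> q = 1) \<or> (d = 2 \<and> q > 1) \<or> (d \<ge> 3 \<and> q = real d / 2)"

primrec regular_potential :: "('a::euclidean_space) potential \<Rightarrow> bool" where
  "regular_potential (Function_potential v) \<longleftrightarrow>
     v \<in> borel_measurable lborel \<and> vanishes_at_infinity v \<and>
     (\<exists>q v1 v2. admissible_exponent DIM('a) q \<and> v1 \<in> Lp q \<and> v2 \<in> Linf \<and>
        (AE x in lborel. v x = v1 x + v2 x))"
| "regular_potential (Measure_potential m n w) \<longleftrightarrow>
     DIM('a) = 1 \<and>
     sets m = sets borel \<and> finite_measure m \<and> sets n = sets borel \<and> finite_measure n \<and>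
     w \<in> Linf \<and> vanishes_at_infinity w"

text \<open>The bilinear form $\int V f g$.\<close>

primrec potential_form ::
    "('a::euclidean_space) potential \<Rightarrow> ('a \<Rightarrow> real) \<Rightarrow> ('a \<Rightarrow> real) \<Rightarrow> real" where
  "potential_form (Function_potential v) f g = (LINT x|lborel. v x * f x * g x)"
| "potential_form (Measure_potential m n w) f g =
     (LINT x|m. cont_rep f x * cont_rep g x) - (LINT x|n. cont_rep f x * cont_rep g x) +
     (LINT x|lborel. w x * f x * g x)"

definition nonpositive_potential :: "('a::euclidean_space) potential \<Rightarrow> bool" where
  "nonpositive_potential V \<longleftrightarrow> (\<forall>\<psi>\<in>H1. potential_form V \<psi> \<psi> \<le> 0)"


subsection \<open>The Schroedinger operator, action and Nehari functional\<close>

text \<open>The distribution $-\Delta f + V f + \omega f$ is an element of $H^{-1}$, the dual of $H^1$;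
  \<open>schroedinger_form \<omega> V f\<close> is this functional. It lies in $L^2$ if it is
  represented by an $L^2$ function, which then is the value of \<open>schroedinger_op\<close>.\<close>

definition schroedinger_form ::
    "real \<Rightarrow> ('a::euclidean_space) potential \<Rightarrow> ('a \<Rightarrow> real) \<Rightarrow> ('a \<Rightarrow> real) \<Rightarrow> real" where
  "schroedinger_form \<omega> V f \<psi> =
     (LINT x|lborel. weak_gradient f x \<bullet> weak_gradient \<psi> x) +
     potential_form V f \<psi> + \<omega> * (LINT x|lborel. f x * \<psi> x)"

definition represents_schroedinger ::
    "real \<Rightarrow> ('a::euclidean_space) potential \<Rightarrow> ('a \<Rightarrow> real) \<Rightarrow> ('a \<Rightarrow> real) \<Rightarrow> bool" where
  "represents_schroedinger \<omega> V f h \<longleftrightarrow>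
     h \<in> Lp 2 \<and> (\<forall>\<psi>\<in>H1. schroedinger_form \<omega> V f \<psi> = l2_inner h \<psi>)"

definition schroedinger_domain ::
    "real \<Rightarrow> ('a::euclidean_space) potential \<Rightarrow> ('a \<Rightarrow> real) set" where
  "schroedinger_domain \<omega> V = {f \<in> H1. \<exists>h. represents_schroedinger \<omega> V f h}"

definition schroedinger_op ::
    "real \<Rightarrow> ('a::euclidean_space) potential \<Rightarrow> ('a \<Rightarrow> real) \<Rightarrow> 'a \<Rightarrow> real" where
  "schroedinger_op \<omega> V f = (SOME h. represents_schroedinger \<omega> V f h)"

definition omega0 :: "('a::euclidean_space) potential \<Rightarrow> real" where
  "omega0 V = - Inf {(LINT x|lborel. (norm (weak_gradient f x))\<^sup>2) + potential_form V f f | f.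
      f \<in> H1 \<and> lp_norm 2 f = 1}"

definition action ::
    "real \<Rightarrow> real \<Rightarrow> ('a::euclidean_space) potential \<Rightarrow> ('a \<Rightarrow> real) \<Rightarrow> real" where
  "action \<alpha> \<omega> V f =
     (LINT x|lborel. (norm (weak_gradient f x))\<^sup>2) + potential_form V f f +
     \<omega> * (LINT x|lborel. \<bar>f x\<bar>\<^sup>2) -
     1 / (\<alpha> + 1) * (LINT x|lborel. \<bar>f x\<bar> powr (2 * \<alpha> + 2))"

definition nehari ::
    "real \<Rightarrow> real \<Rightarrow> ('a::euclidean_space) potential \<Rightarrow> ('a \<Rightarrow> real) \<Rightarrow> real" where
  "nehari \<alpha> \<omega> V f =
     (LINT x|lborel. (norm (weak_gradient f x))\<^sup>2) + potential_form V f f +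
     \<omega> * (LINT x|lborel. \<bar>f x\<bar>\<^sup>2) -
     (LINT x|lborel. \<bar>f x\<bar> powr (2 * \<alpha> + 2))"

definition nehari_manifold ::
    "real \<Rightarrow> real \<Rightarrow> ('a::euclidean_space) potential \<Rightarrow> ('a \<Rightarrow> real) set" where
  "nehari_manifold \<alpha> \<omega> V =
     {f \<in> H1. \<not> (AE x in lborel. f x = 0) \<and> nehari \<alpha> \<omega> V f = 0}"


subsection \<open>The continuous normalized gradient flow\<close>

definition nonlinearity :: "real \<Rightarrow> ('a \<Rightarrow> real) \<Rightarrow> 'a \<Rightarrow> real" where
  "nonlinearity \<alpha> f = (\<lambda>x. \<bar>f x\<bar> powr (2 * \<alpha>) * f x)"

definition flow_multiplier ::
    "real \<Rightarrow> real \<Rightarrow> ('a::euclidean_space) potential \<Rightarrow> ('a \<Rightarrow> real) \<Rightarrow> real" where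
  "flow_multiplier \<alpha> \<omega> V f =
     - ((lp_norm 2 (schroedinger_op \<omega> V f))\<^sup>2
        - (\<alpha> + 2) * l2_inner (schroedinger_op \<omega> V f) (nonlinearity \<alpha> f)
        + (\<alpha> + 1) * lp_norm (4 * \<alpha> + 2) f powr (4 * \<alpha> + 2))
       / (\<alpha> * lp_norm (2 * \<alpha> + 2) f powr (2 * \<alpha> + 2))"

text \<open>Strong solutions on $[0,T]$: the quantities occurring in the equation and in the
  multiplier are meaningful at every time (in particular the denominator of the multiplier
  does not vanish) and continuous in time, and the equation holds in $L^2$. At the endpoints
  of the interval the time derivative is one-sided.\<close>

definition gradient_flow_solution ::
    "real \<Rightarrow> real \<Rightarrow> ('a::euclidean_space) potential \<Rightarrow> real \<Rightarrow> (real \<Rightarrow> 'a \<Rightarrow> real) \<Rightarrow> bool" where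
  "gradient_flow_solution \<alpha> \<omega> V T \<phi> \<longleftrightarrow>
     (\<forall>t\<in>{0..T}. \<phi> t \<in> schroedinger_domain \<omega> V \<and> \<not> (AE x in lborel. \<phi> t x = 0)) \<and>
     lp_continuous_on 2 {0..T} (\<lambda>t. schroedinger_op \<omega> V (\<phi> t)) \<and>
     lp_continuous_on (4 * \<alpha> + 2) {0..T} \<phi> \<and>
     (\<forall>t\<in>{0..T}. l2_has_time_derivative \<phi>
        (\<lambda>x. - schroedinger_op \<omega> V (\<phi> t) x + nonlinearity \<alpha> (\<phi> t) x
              + flow_multiplier \<alpha> \<omega> V (\<phi> t) * \<phi> t x)
        t {0..T})"

end

theory Submission
  imports Defs
begin

text \<open>
  Write \<open>h = H\<^sub>\<omega>\<phi>\<close>, \<open>N = |\<phi>|\<^sup>2\<^sup>\<alpha>\<phi>\<close>, \<open>E = \<langle>h, \<phi>\<rangle>\<close> and \<open>P = \<integral>|\<phi>|\<^sup>2\<^sup>\<alpha>\<^sup>+\<^sup>2 = \<langle>N, \<phi>\<rangle>\<close>, so that the Nehari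
  functional is \<open>E - P\<close> and the action is \<open>E - P / (\<alpha> + 1)\<close>. Since the quadratic form is
  symmetric, \<open>E' = 2\<langle>h, \<phi>'\<rangle>\<close>, with no derivative of \<open>h\<close> required; convexity of
  \<open>|\<cdot>|\<^sup>2\<^sup>\<alpha>\<^sup>+\<^sup>2\<close> squeezes the difference quotients of \<open>P\<close> and gives
  \<open>P' = (2\<alpha> + 2)\<langle>N, \<phi>'\<rangle>\<close>. The multiplier is chosen such that
  \<open>(E - P)' = 2\<mu>(E - P)\<close>; as \<open>\<mu>\<close> is continuous, \<open>E - P\<close> vanishes identically if it vanishes
  initially. On \<open>E = P\<close> the derivative of the action is \<open>-2\<parallel>h - N\<parallel>\<^sup>2\<close>.
\<close>

section \<open>The space $L^2$\<close>

lemma Lp_2_iff: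
  "f \<in> Lp 2 \<longleftrightarrow> f \<in> borel_measurable lborel \<and> integrable lborel (\<lambda>x. (f x)\<^sup>2)"
  by (simp add: Lp_def)

lemma Lp_measurable: "f \<in> Lp p \<Longrightarrow> f \<in> borel_measurable lborel"
  by (simp add: Lp_def)

lemma integrable_mult_Lp_2:
  assumes "f \<in> Lp 2" "g \<in> Lp 2"
  shows "integrable lborel (\<lambda>x. f x * g x)"
proof (rule Bochner_Integration.integrable_bound)
  show "integrable lborel (\<lambda>x. (f x)\<^sup>2 + (g x)\<^sup>2)"
    using assms by (simp add: Lp_2_iff)
  show "(\<lambda>x. f x * g x) \<in> borel_measurable lborel"
    using assms by (auto simp: Lp_2_iff)
  have "\<bar>f x * g x\<bar> \<le> (f x)\<^sup>2 + (g x)\<^sup>2" for x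
  proof -
    have "0 \<le> (\<bar>f x\<bar> - \<bar>g x\<bar>)\<^sup>2" by simp
    then have "2 * \<bar>f x * g x\<bar> \<le> (f x)\<^sup>2 + (g x)\<^sup>2"
      by (simp add: power2_diff abs_mult)
    then show ?thesis by linarith
  qed
  then show "AE x in lborel. norm (f x * g x) \<le> norm ((f x)\<^sup>2 + (g x)\<^sup>2)"
    by simp
qed

lemma Lp_2_cmult: "f \<in> Lp 2 \<Longrightarrow> (\<lambda>x. c * f x) \<in> Lp 2"
  by (auto simp: Lp_2_iff power_mult_distrib)

lemma Lp_2_add:
  assumes "f \<in> Lp 2" "g \<in> Lp 2"
  shows "(\<lambda>x. f x + g x) \<in> Lp 2"
  using assms integrable_mult_Lp_2[OF assms]
  by (auto simp: Lp_2_iff power2_sum mult.assoc)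

lemma Lp_2_diff:
  assumes "f \<in> Lp 2" "g \<in> Lp 2"
  shows "(\<lambda>x. f x - g x) \<in> Lp 2"
  using Lp_2_add[OF assms(1) Lp_2_cmult[OF assms(2), of "-1"]] by simp

lemma l2_inner_commute: "l2_inner f g = l2_inner g f"
  by (simp add: l2_inner_def mult.commute)

lemma l2_inner_add_left:
  assumes "f \<in> Lp 2" "g \<in> Lp 2" "k \<in> Lp 2"
  shows "l2_inner (\<lambda>x. f x + g x) k = l2_inner f k + l2_inner g k"
  using assms by (simp add: l2_inner_def distrib_right integrable_mult_Lp_2)

lemma l2_inner_cmult_left: "l2_inner (\<lambda>x. c * f x) k = c * l2_inner f k"
  by (simp add: l2_inner_def mult.assoc)

lemma l2_inner_diff_left:
  assumes "f \<in> Lp 2" "g \<in> Lp 2" "k \<in> Lp 2"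
  shows "l2_inner (\<lambda>x. f x - g x) k = l2_inner f k - l2_inner g k"
  using assms by (simp add: l2_inner_def left_diff_distrib integrable_mult_Lp_2)

lemma l2_inner_add_right:
  assumes "f \<in> Lp 2" "g \<in> Lp 2" "k \<in> Lp 2"
  shows "l2_inner k (\<lambda>x. f x + g x) = l2_inner k f + l2_inner k g"
  using l2_inner_add_left[OF assms] by (simp add: l2_inner_commute)

lemma l2_inner_cmult_right: "l2_inner k (\<lambda>x. c * f x) = c * l2_inner k f"
  using l2_inner_cmult_left[of c f k] by (simp add: l2_inner_commute)

lemma l2_inner_diff_right:
  assumes "f \<in> Lp 2" "g \<in> Lp 2" "k \<in> Lp 2"
  shows "l2_inner k (\<lambda>x. f x - g x) = l2_inner k f - l2_inner k g"
  using l2_inner_diff_left[OF assms] by (simp add: l2_inner_commute)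

lemma l2_inner_self_nonneg: "0 \<le> l2_inner f f"
  by (simp add: l2_inner_def)

lemma lp_norm_nonneg: "0 \<le> lp_norm p f"
  by (simp add: lp_norm_def)

lemma lp_norm_powr: "p \<noteq> 0 \<Longrightarrow> lp_norm p f powr p = (LINT x|lborel. \<bar>f x\<bar> powr p)"
  by (simp add: lp_norm_def powr_powr)

lemma lp_norm_2_power2: "(lp_norm 2 f)\<^sup>2 = l2_inner f f"
  using lp_norm_powr[of 2 f] lp_norm_nonneg[of 2 f]
  by (simp add: l2_inner_def power2_eq_square)

lemma lp_norm_2_eq_sqrt: "lp_norm 2 f = sqrt (l2_inner f f)"
  by (metis lp_norm_2_power2 lp_norm_nonneg real_sqrt_unique)

text \<open>The square of s f - r g integrates to a nonnegative quadratic form in s and r; the bound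
  says that its discriminant is not positive. Keeping both coefficients free avoids dividing by the
  norm of g, which may vanish.\<close>

lemma l2_inner_Cauchy_Schwarz:
  assumes f: "f \<in> Lp 2" and g: "g \<in> Lp 2"
  shows "\<bar>l2_inner f g\<bar> \<le> lp_norm 2 f * lp_norm 2 g"
proof -
  define a b c where "a = l2_inner f f" and "b = l2_inner f g" and "c = l2_inner g g"
  have quad: "0 \<le> s\<^sup>2 * a - 2 * s * r * b + r\<^sup>2 * c" for s r
  proof -
    have "0 \<le> l2_inner (\<lambda>x. s * f x - r * g x) (\<lambda>x. s * f x - r * g x)"
      by (rule l2_inner_self_nonneg)
    also have "\<dots> = s\<^sup>2 * a - 2 * s * r * b + r\<^sup>2 * c"
      using f g
      by (simp add: l2_inner_diff_left l2_inner_diff_right l2_inner_cmult_left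
          l2_inner_cmult_right Lp_2_diff Lp_2_cmult a_def b_def c_def
          l2_inner_commute[of g f] algebra_simps power2_eq_square)
    finally show ?thesis .
  qed
  have "b\<^sup>2 \<le> a * c"
  proof (cases "c = 0")
    case True
    have "b = 0"
    proof (rule ccontr)
      assume "b \<noteq> 0"
      then show False
        \<comment> \<open>With c = 0 these coefficients give the form the value a - (a + 1) =
          -1.\<close>
        using quad[of 1 "(a + 1) / (2 * b)"] True by simp
    qed
    then show ?thesis using True by simp
  next
    case False
    then have "c > 0" using l2_inner_self_nonneg[of g] by (simp add: c_def)
    have "0 \<le> c * (a * c - b\<^sup>2)"
      \<comment> \<open>At s = c and r = b the form factors as c (a c - b^2).\<close>
      using quad[of c b] by (simp add: algebra_simps power2_eq_square)
    then show ?thesis using \<open>c > 0\<close> by (simp add: zero_le_mult_iff)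
  qed
  then have "\<bar>b\<bar> \<le> sqrt (a * c)"
    using real_sqrt_le_mono by fastforce
  then show ?thesis
    by (simp add: lp_norm_2_eq_sqrt real_sqrt_mult a_def b_def c_def)
qed

text \<open>Both arguments may move: the difference of the inner products splits into three terms,
  each containing \<open>u s - f\<close> or \<open>v s - g\<close>, and Cauchy-Schwarz makes each of
  them small. This yields limits of difference quotients paired with moving functions, and the
  continuity in time of the multiplier.\<close>

lemma l2_inner_tendsto:
  assumes uF: "\<forall>\<^sub>F s in F. u s \<in> Lp 2" and vF: "\<forall>\<^sub>F s in F. v s \<in> Lp 2"
    and f: "f \<in> Lp 2" and g: "g \<in> Lp 2"
    and u: "((\<lambda>s. lp_norm 2 (\<lambda>x. u s x - f x)) \<longlongrightarrow> 0) F"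
    and v: "((\<lambda>s. lp_norm 2 (\<lambda>x. v s x - g x)) \<longlongrightarrow> 0) F"
  shows "((\<lambda>s. l2_inner (u s) (v s)) \<longlongrightarrow> l2_inner f g) F"
proof (rule Lim_transform2[OF tendsto_const], rule Lim_null_comparison)
  let ?a = "\<lambda>s. lp_norm 2 (\<lambda>x. u s x - f x)" and ?b = "\<lambda>s. lp_norm 2 (\<lambda>x. v s x - g x)"
  show "((\<lambda>s. ?a s * ?b s + ?a s * lp_norm 2 g + lp_norm 2 f * ?b s) \<longlongrightarrow> 0) F"
    by (rule tendsto_eq_intros u v refl | simp)+
  show "\<forall>\<^sub>F s in F. norm (l2_inner f g - l2_inner (u s) (v s))
          \<le> ?a s * ?b s + ?a s * lp_norm 2 g + lp_norm 2 f * ?b s"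
    using uF vF
  proof eventually_elim
    case (elim s)
    have "l2_inner (u s) (v s) - l2_inner f g =
        l2_inner (\<lambda>x. u s x - f x) (\<lambda>x. v s x - g x) + l2_inner (\<lambda>x. u s x - f x) g
        + l2_inner f (\<lambda>x. v s x - g x)"
      using elim f g by (simp add: l2_inner_diff_left l2_inner_diff_right Lp_2_diff)
    then show ?case
      using l2_inner_Cauchy_Schwarz[OF Lp_2_diff[OF elim(1) f] Lp_2_diff[OF elim(2) g]]
        l2_inner_Cauchy_Schwarz[OF Lp_2_diff[OF elim(1) f] g]
        l2_inner_Cauchy_Schwarz[OF f Lp_2_diff[OF elim(2) g]]
      unfolding real_norm_def by linarith
  qed
qed

section \<open>The nonlinearity\<close>

lemma Lp_diff:
  assumes "f \<in> Lp p" "g \<in> Lp p" "0 \<le> p"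
  shows "(\<lambda>x. f x - g x) \<in> Lp p"
proof -
  have "integrable lborel (\<lambda>x. \<bar>f x - g x\<bar> powr p)"
  proof (rule Bochner_Integration.integrable_bound)
    show "integrable lborel (\<lambda>x. 2 powr p * (\<bar>f x\<bar> powr p + \<bar>g x\<bar> powr p))"
      using assms by (simp add: Lp_def)
    show "(\<lambda>x. \<bar>f x - g x\<bar> powr p) \<in> borel_measurable lborel"
      using assms by (auto simp: Lp_def)
    \<comment> \<open>Only integrability is wanted, so it is enough that |a - b| is at most twice
      the larger modulus; this covers every exponent \<open>p\<close> that is at least 0.\<close>
    have "\<bar>a - b\<bar> powr p \<le> 2 powr p * (\<bar>a\<bar> powr p + \<bar>b\<bar> powr p)" for a b :: real
    proof -
      have "\<bar>a - b\<bar> powr p \<le> (2 * max \<bar>a\<bar> \<bar>b\<bar>) powr p"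
        using assms(3) by (intro powr_mono2) auto
      also have "\<dots> = 2 powr p * (max \<bar>a\<bar> \<bar>b\<bar>) powr p"
        by (simp add: powr_mult)
      also have "\<dots> \<le> 2 powr p * (\<bar>a\<bar> powr p + \<bar>b\<bar> powr p)"
        by (intro mult_left_mono) (auto simp: max_def)
      finally show ?thesis .
    qed
    then show "AE x in lborel. norm (\<bar>f x - g x\<bar> powr p)
        \<le> norm (2 powr p * (\<bar>f x\<bar> powr p + \<bar>g x\<bar> powr p))"
      by simp
  qed
  then show ?thesis using assms by (auto simp: Lp_def)
qed

lemma nonlinearity_power2:
  assumes "0 < \<alpha>"
  shows "(nonlinearity \<alpha> f x)\<^sup>2 = \<bar>f x\<bar> powr (4 * \<alpha> + 2)"
proof (cases "f x = 0")
  case False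
  have "(nonlinearity \<alpha> f x)\<^sup>2 = (\<bar>f x\<bar> powr (2 * \<alpha>))\<^sup>2 * \<bar>f x\<bar>\<^sup>2"
    by (simp add: nonlinearity_def power_mult_distrib)
  also have "\<dots> = \<bar>f x\<bar> powr (2 * \<alpha>) * \<bar>f x\<bar> powr (2 * \<alpha>) * \<bar>f x\<bar> powr 2"
    using False by (simp add: power2_eq_square)
  also have "\<dots> = \<bar>f x\<bar> powr (2 * \<alpha> + 2 * \<alpha> + 2)"
    by (simp only: powr_add)
  finally show ?thesis by simp
qed (use assms in \<open>simp add: nonlinearity_def\<close>)

lemma nonlinearity_mult_self:
  assumes "0 < \<alpha>"
  shows "nonlinearity \<alpha> f x * f x = \<bar>f x\<bar> powr (2 * \<alpha> + 2)"
proof (cases "f x = 0")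
  case False
  have "nonlinearity \<alpha> f x * f x = \<bar>f x\<bar> powr (2 * \<alpha>) * \<bar>f x\<bar> powr 2"
    using False by (simp add: nonlinearity_def power2_eq_square)
  then show ?thesis by (simp only: powr_add)
qed (use assms in \<open>simp add: nonlinearity_def\<close>)

lemma abs_nonlinearity:
  assumes "0 < \<alpha>" shows "\<bar>nonlinearity \<alpha> f x\<bar> = \<bar>f x\<bar> powr (2 * \<alpha> + 1)"
  using assms by (cases "f x = 0") (simp_all add: nonlinearity_def abs_mult powr_add)

lemma nonlinearity_in_Lp_2:
  assumes "0 < \<alpha>" "f \<in> Lp (4 * \<alpha> + 2)"
  shows "nonlinearity \<alpha> f \<in> Lp 2"
proof -
  have "nonlinearity \<alpha> f \<in> borel_measurable lborel"
    using Lp_measurable[OF assms(2)] unfolding nonlinearity_def by simp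
  then show ?thesis
    using assms by (simp add: Lp_2_iff nonlinearity_power2) (simp add: Lp_def)
qed

text \<open>By homogeneity it suffices to treat \<open>g x = 1\<close>: near \<open>1\<close> use continuity, and at distance at
  least \<open>\<delta>\<close> from \<open>1\<close> everything is dominated by a power of the distance. The estimate replaces
  Hoelder's inequality in the proof that \<open>f \<mapsto> nonlinearity \<alpha> f\<close> is continuous into $L^2$.\<close>

lemma nonlinearity_diff_bound:
  assumes "0 < \<alpha>" "0 < \<epsilon>"
  obtains C where "0 \<le> C"
    "\<And>f g x. (nonlinearity \<alpha> f x - nonlinearity \<alpha> g x)\<^sup>2
      \<le> \<epsilon> * \<bar>g x\<bar> powr (4 * \<alpha> + 2) + C * \<bar>f x - g x\<bar> powr (4 * \<alpha> + 2)"
proof -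
  define m where "m = 2 * \<alpha> + 1"
  define N :: "real \<Rightarrow> real" where "N r = \<bar>r\<bar> powr (2 * \<alpha>) * r" for r
  have m: "m > 0" using assms by (simp add: m_def)
  have sq: "(r powr m)\<^sup>2 = r powr (4 * \<alpha> + 2)" for r :: real
    by (simp add: power2_eq_square powr_add[symmetric] m_def)
  have absN: "\<bar>N r\<bar> = \<bar>r\<bar> powr m" for r
    using assms by (cases "r = 0") (simp_all add: N_def m_def abs_mult powr_add)
  have "isCont N 1" unfolding N_def by (intro continuous_intros) auto
  then obtain \<delta> where \<delta>: "\<delta> > 0" "\<And>r. \<bar>r - 1\<bar> < \<delta> \<Longrightarrow> \<bar>N r - N 1\<bar> < sqrt \<epsilon>"
    using assms(2) unfolding continuous_at_eps_delta dist_real_def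
    by (metis real_sqrt_gt_zero)
  \<comment> \<open>For y = |r - 1| at least \<open>\<delta>\<close>, both 1 \<le> y / \<delta> and
    |r| \<le> y + 1 \<le> y (1 + 1/\<delta>) hold. The two summands of \<open>K\<close> are the
    factors that then bound |N r| and 1 by multiples of \<open>y powr m\<close>.\<close>
  define K where "K = (1 + 1 / \<delta>) powr m + (1 / \<delta>) powr m"
  have K: "K \<ge> 0" by (simp add: K_def)
  have N1: "(N r - 1)\<^sup>2 \<le> \<epsilon> + K\<^sup>2 * \<bar>r - 1\<bar> powr (4 * \<alpha> + 2)" for r
  proof (cases "\<bar>r - 1\<bar> < \<delta>")
    case True
    then have "\<bar>N r - 1\<bar> < sqrt \<epsilon>" using \<delta>(2)[of r] by (simp add: N_def)
    then have "\<bar>N r - 1\<bar>\<^sup>2 \<le> (sqrt \<epsilon>)\<^sup>2" by (intro power_mono) auto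
    then have "(N r - 1)\<^sup>2 \<le> \<epsilon>" using assms(2) by simp
    moreover have "0 \<le> K\<^sup>2 * \<bar>r - 1\<bar> powr (4 * \<alpha> + 2)" by simp
    ultimately show ?thesis by linarith
  next
    case False
    define y where "y = \<bar>r - 1\<bar>"
    have y: "1 \<le> y / \<delta>" "0 \<le> y" using False \<delta>(1) by (auto simp: y_def)
    have "\<bar>N r - 1\<bar> \<le> \<bar>r\<bar> powr m + 1" using absN[of r] by linarith
    also have "\<dots> \<le> (y * (1 + 1 / \<delta>)) powr m + (y * (1 / \<delta>)) powr m"
    proof (rule add_mono)
      have "\<bar>r\<bar> \<le> y * (1 + 1 / \<delta>)"
        using y by (simp add: y_def algebra_simps)
      then show "\<bar>r\<bar> powr m \<le> (y * (1 + 1 / \<delta>)) powr m"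
        using m by (intro powr_mono2) auto
      show "1 \<le> (y * (1 / \<delta>)) powr m"
        using y m by (simp add: ge_one_powr_ge_zero)
    qed
    also have "\<dots> = K * y powr m"
      unfolding K_def powr_mult by (simp add: algebra_simps)
    finally have "\<bar>N r - 1\<bar>\<^sup>2 \<le> (K * y powr m)\<^sup>2" by (intro power_mono) auto
    then have "(N r - 1)\<^sup>2 \<le> K\<^sup>2 * y powr (4 * \<alpha> + 2)"
      by (simp add: power_mult_distrib sq)
    then show ?thesis using assms(2) by (simp add: y_def)
  qed
  have main: "(N a - N b)\<^sup>2 \<le> \<epsilon> * \<bar>b\<bar> powr (4 * \<alpha> + 2)
      + max 1 (K\<^sup>2) * \<bar>a - b\<bar> powr (4 * \<alpha> + 2)" for a b
  proof (cases "b = 0")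
    \<comment> \<open>Dividing by \<open>b\<close> is impossible here, but the left side is just the
      power of |a|; this case is the reason for the maximum with 1 in the constant.\<close>
    case True
    have "(N a)\<^sup>2 = \<bar>a\<bar> powr (4 * \<alpha> + 2)" using absN[of a] sq[of "\<bar>a\<bar>"] by (metis power2_abs)
    moreover have "1 * \<bar>a\<bar> powr (4 * \<alpha> + 2) \<le> max 1 (K\<^sup>2) * \<bar>a\<bar> powr (4 * \<alpha> + 2)"
      by (intro mult_right_mono) auto
    ultimately show ?thesis using True assms by (simp add: N_def)
  next
    case False
    have hom: "N a = N b * N (a / b)"
      using False by (simp add: N_def abs_divide powr_divide)
    have "(N a - N b)\<^sup>2 = (N b)\<^sup>2 * (N (a / b) - 1)\<^sup>2"
      unfolding hom by (simp add: power2_eq_square algebra_simps)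
    also have "(N b)\<^sup>2 = \<bar>b\<bar> powr (4 * \<alpha> + 2)" using absN[of b] sq[of "\<bar>b\<bar>"] by (metis power2_abs)
    also have "\<bar>b\<bar> powr (4 * \<alpha> + 2) * (N (a / b) - 1)\<^sup>2
        \<le> \<bar>b\<bar> powr (4 * \<alpha> + 2) * (\<epsilon> + K\<^sup>2 * \<bar>a / b - 1\<bar> powr (4 * \<alpha> + 2))"
      by (intro mult_left_mono N1) auto
    also have "\<dots> = \<epsilon> * \<bar>b\<bar> powr (4 * \<alpha> + 2)
        + K\<^sup>2 * (\<bar>b\<bar> * \<bar>a / b - 1\<bar>) powr (4 * \<alpha> + 2)"
      by (simp add: powr_mult algebra_simps)
    also have "\<bar>b\<bar> * \<bar>a / b - 1\<bar> = \<bar>a - b\<bar>"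
      using False by (simp add: abs_mult[symmetric] right_diff_distrib)
    also have "K\<^sup>2 * \<bar>a - b\<bar> powr (4 * \<alpha> + 2) \<le> max 1 (K\<^sup>2) * \<bar>a - b\<bar> powr (4 * \<alpha> + 2)"
      by (intro mult_right_mono) auto
    finally show ?thesis by simp
  qed
  show thesis
    by (rule that[of "max 1 (K\<^sup>2)"]) (use main in \<open>auto simp: nonlinearity_def N_def\<close>)
qed

lemma nonlinearity_continuous:
  fixes u :: "real \<Rightarrow> 'a::euclidean_space \<Rightarrow> real"
  assumes \<alpha>: "0 < \<alpha>" and u: "lp_continuous_on (4 * \<alpha> + 2) J u"
  shows "lp_continuous_on 2 J (\<lambda>t. nonlinearity \<alpha> (u t))"
  unfolding lp_continuous_on_def
proof (intro conjI ballI)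
  fix t assume t: "t \<in> J"
  define p where "p = 4 * \<alpha> + 2"
  have p: "p > 0" using \<alpha> by (simp add: p_def)
  have Lp: "u s \<in> Lp p" if "s \<in> J" for s
    using u that by (simp add: lp_continuous_on_def p_def)
  then show N: "nonlinearity \<alpha> (u t) \<in> Lp 2"
    using \<alpha> t by (simp add: nonlinearity_in_Lp_2 p_def)
  let ?F = "at t within J"
  have inJ: "\<forall>\<^sub>F s in ?F. s \<in> J" by (simp add: eventually_at_filter)
  have "((\<lambda>s. lp_norm p (\<lambda>x. u s x - u t x)) \<longlongrightarrow> 0) ?F"
    using u t by (simp add: lp_continuous_on_def p_def)
  then have "((\<lambda>s. lp_norm p (\<lambda>x. u s x - u t x) powr p) \<longlongrightarrow> 0 powr p) ?F"
    by (rule tendsto_powr'[OF _ tendsto_const]) (use p in \<open>auto simp: lp_norm_nonneg\<close>)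
  then have D: "((\<lambda>s. LINT x|lborel. \<bar>u s x - u t x\<bar> powr p) \<longlongrightarrow> 0) ?F"
    using p by (simp add: lp_norm_powr)
  let ?d = "\<lambda>s x. nonlinearity \<alpha> (u s) x - nonlinearity \<alpha> (u t) x"
  have "((\<lambda>s. l2_inner (?d s) (?d s)) \<longlongrightarrow> 0) ?F"
  proof (rule tendstoI)
    fix e :: real assume e: "e > 0"
    \<comment> \<open>Weighting the fixed function by \<open>e / (2 * (K + 1))\<close> makes its
      share of the integral at most e/2; adding 1 keeps the weight defined when \<open>K\<close> is
      0. The other share tends to 0 because \<open>C\<close> does not depend on
      \<open>s\<close>.\<close>
    define K where "K = (LINT x|lborel. \<bar>u t x\<bar> powr p)"
    have K: "K \<ge> 0" by (simp add: K_def)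
    obtain C where C: "0 \<le> C"
      "\<And>f g (x :: 'a). (nonlinearity \<alpha> f x - nonlinearity \<alpha> g x)\<^sup>2
        \<le> e / (2 * (K + 1)) * \<bar>g x\<bar> powr p + C * \<bar>f x - g x\<bar> powr p"
      using nonlinearity_diff_bound[OF \<alpha>, of "e / (2 * (K + 1))"] e K unfolding p_def
      by (metis add_nonneg_pos divide_pos_pos mult_pos_pos zero_less_numeral zero_less_one)
    have "((\<lambda>s. C * (LINT x|lborel. \<bar>u s x - u t x\<bar> powr p)) \<longlongrightarrow> C * 0) ?F"
      by (intro tendsto_intros D)
    then have "\<forall>\<^sub>F s in ?F. C * (LINT x|lborel. \<bar>u s x - u t x\<bar> powr p) < e / 2"
      using e by (intro order_tendstoD) auto
    then show "\<forall>\<^sub>F s in ?F. dist (l2_inner (?d s) (?d s)) 0 < e"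
      using inJ
    proof eventually_elim
      case (elim s)
      have i1: "integrable lborel (\<lambda>x. \<bar>u t x\<bar> powr p)"
        using Lp[OF t] by (simp add: Lp_def)
      have i2: "integrable lborel (\<lambda>x. \<bar>u s x - u t x\<bar> powr p)"
        using Lp_diff[OF Lp[OF elim(2)] Lp[OF t]] p by (simp add: Lp_def)
      have "l2_inner (?d s) (?d s) = (LINT x|lborel. (?d s x)\<^sup>2)"
        by (simp add: l2_inner_def power2_eq_square)
      also have "\<dots> \<le> (LINT x|lborel. e / (2 * (K + 1)) * \<bar>u t x\<bar> powr p
          + C * \<bar>u s x - u t x\<bar> powr p)"
      proof (rule integral_mono)
        have "?d s \<in> Lp 2"
          using Lp_2_diff[OF nonlinearity_in_Lp_2 N] \<alpha> Lp[OF elim(2)] by (simp add: p_def)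
        then show "integrable lborel (\<lambda>x. (?d s x)\<^sup>2)" by (simp add: Lp_2_iff)
        show "integrable lborel (\<lambda>x. e / (2 * (K + 1)) * \<bar>u t x\<bar> powr p
            + C * \<bar>u s x - u t x\<bar> powr p)"
          using i1 i2 by simp
      qed (rule C(2))
      also have "\<dots> = e / (2 * (K + 1)) * K + C * (LINT x|lborel. \<bar>u s x - u t x\<bar> powr p)"
        using i1 i2 by (simp add: K_def)
      also have "\<dots> < e / (2 * (K + 1)) * K + e / 2" using elim(1) by simp
      also have "\<dots> \<le> e" using e K by (simp add: field_simps)
      finally show ?case using l2_inner_self_nonneg[of "?d s"] by simp
    qed
  qed
  then have "((\<lambda>s. sqrt (l2_inner (?d s) (?d s))) \<longlongrightarrow> sqrt 0) ?F"
    by (rule tendsto_real_sqrt)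
  then show "((\<lambda>s. lp_norm 2 (?d s)) \<longlongrightarrow> 0) ?F"
    by (simp add: lp_norm_2_eq_sqrt)
qed

text \<open>The graph of the convex function |y|^r, with r = 2\<alpha> + 2, lies above its tangent
  at \<open>f x\<close>. Young's inequality with the conjugate exponents r/(r - 1) and r gives this
  without differentiating the power.\<close>

lemma abs_powr_tangent_bound:
  assumes "0 < \<alpha>"
  shows "\<bar>f x\<bar> powr (2 * \<alpha> + 2) - \<bar>g x\<bar> powr (2 * \<alpha> + 2)
    \<le> (2 * \<alpha> + 2) * (nonlinearity \<alpha> f x * (f x - g x :: real))"
proof -
  define r where "r = 2 * \<alpha> + 2"
  have r: "r > 1" using assms by (simp add: r_def)
  have "\<bar>f x\<bar> powr (r - 1) * \<bar>g x\<bar>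
      \<le> (\<bar>f x\<bar> powr (r - 1)) powr (r / (r - 1)) / (r / (r - 1)) + \<bar>g x\<bar> powr r / r"
    using r by (intro Youngs_inequality) (auto simp: field_simps)
  also have "(\<bar>f x\<bar> powr (r - 1)) powr (r / (r - 1)) = \<bar>f x\<bar> powr r"
    using r by (simp add: powr_powr)
  finally have "r * (\<bar>f x\<bar> powr (r - 1) * \<bar>g x\<bar>) \<le> (r - 1) * \<bar>f x\<bar> powr r + \<bar>g x\<bar> powr r"
    using r by (simp add: field_simps)
  moreover have "r * (nonlinearity \<alpha> f x * g x) \<le> r * (\<bar>f x\<bar> powr (r - 1) * \<bar>g x\<bar>)"
  proof -
    have "nonlinearity \<alpha> f x * g x \<le> \<bar>nonlinearity \<alpha> f x\<bar> * \<bar>g x\<bar>"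
      by (metis abs_ge_self abs_mult)
    then have "nonlinearity \<alpha> f x * g x \<le> \<bar>f x\<bar> powr (r - 1) * \<bar>g x\<bar>"
      using abs_nonlinearity[OF assms, of f x] by (simp add: r_def add.commute)
    then show ?thesis
      using r by simp
  qed
  ultimately have "r * (nonlinearity \<alpha> f x * g x) \<le> (r - 1) * \<bar>f x\<bar> powr r + \<bar>g x\<bar> powr r"
    by linarith
  moreover have "r * (nonlinearity \<alpha> f x * (f x - g x))
      = r * \<bar>f x\<bar> powr r - r * (nonlinearity \<alpha> f x * g x)"
    using nonlinearity_mult_self[OF assms, of f x] by (simp add: r_def algebra_simps)
  ultimately show ?thesis
    unfolding r_def[symmetric] left_diff_distrib by linarith
qed


section \<open>Time derivatives\<close>

text \<open>The first factor only has to be continuous at \<open>t\<close> in L^2. Applied with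
  \<open>g\<close> moving and with \<open>g\<close> frozen at its value at \<open>t\<close>, it
  provides the two limits that both derivative computations below compare.\<close>

lemma l2_has_time_derivative_inner_left:
  assumes J: "t \<in> J" and u: "\<And>s. s \<in> J \<Longrightarrow> u s \<in> Lp 2" and f: "f \<in> Lp 2"
    and du: "l2_has_time_derivative u f t J"
    and g: "\<And>s. s \<in> J \<Longrightarrow> g s \<in> Lp 2"
    and cg: "((\<lambda>s. lp_norm 2 (\<lambda>x. g s x - g t x)) \<longlongrightarrow> 0) (at t within J)"
  shows "((\<lambda>s. l2_inner (g s) (\<lambda>x. u s x - u t x) / (s - t)) \<longlongrightarrow> l2_inner (g t) f)
    (at t within J)"
proof -
  have inJ: "\<forall>\<^sub>F s in at t within J. s \<in> J" by (simp add: eventually_at_filter)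
  have "((\<lambda>s. l2_inner (g s) (\<lambda>x. 1 / (s - t) * (u s x - u t x))) \<longlongrightarrow> l2_inner (g t) f)
    (at t within J)"
  proof (rule l2_inner_tendsto)
    show "\<forall>\<^sub>F s in at t within J. g s \<in> Lp 2"
      using inJ by eventually_elim (rule g)
    show "\<forall>\<^sub>F s in at t within J. (\<lambda>x. 1 / (s - t) * (u s x - u t x)) \<in> Lp 2"
      using inJ by eventually_elim (intro Lp_2_cmult Lp_2_diff u J)
    show "((\<lambda>s. lp_norm 2 (\<lambda>x. 1 / (s - t) * (u s x - u t x) - f x)) \<longlongrightarrow> 0) (at t within J)"
      using du by (simp add: l2_has_time_derivative_def)
  qed (use g J f cg in auto)
  then show ?thesis by (simp only: l2_inner_cmult_right) simp
qed

text \<open>Symmetry cancels the mixed terms in <h s, u s - u t> + <h t, u s - u t>, leaving exactly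
  the increment of <h, u>. After division by s - t both summands converge to <h t, f>, which
  explains the factor 2.\<close>

lemma symmetric_form_has_derivative:
  assumes J: "t \<in> J" and u: "\<And>s. s \<in> J \<Longrightarrow> u s \<in> Lp 2" and f: "f \<in> Lp 2"
    and du: "l2_has_time_derivative u f t J"
    and h: "lp_continuous_on 2 J h"
    and sym: "\<And>s. s \<in> J \<Longrightarrow> l2_inner (h s) (u t) = l2_inner (h t) (u s)"
  shows "((\<lambda>s. l2_inner (h s) (u s)) has_real_derivative 2 * l2_inner (h t) f) (at t within J)"
proof -
  have hL: "h s \<in> Lp 2" if "s \<in> J" for s
    using h that by (simp add: lp_continuous_on_def)
  have ch: "((\<lambda>s. lp_norm 2 (\<lambda>x. h s x - h t x)) \<longlongrightarrow> 0) (at t within J)"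
    using h J by (simp add: lp_continuous_on_def)
  have inJ: "\<forall>\<^sub>F s in at t within J. s \<in> J" by (simp add: eventually_at_filter)
  have "((\<lambda>s. l2_inner (h s) (\<lambda>x. u s x - u t x) / (s - t)
      + l2_inner (h t) (\<lambda>x. u s x - u t x) / (s - t))
      \<longlongrightarrow> l2_inner (h t) f + l2_inner (h t) f) (at t within J)"
    by (intro tendsto_add l2_has_time_derivative_inner_left[OF J u f du hL ch]
        l2_has_time_derivative_inner_left[OF J u f du, of "\<lambda>_. h t", simplified])
      (simp_all add: hL J lp_norm_def)
  moreover have "\<forall>\<^sub>F s in at t within J.
      l2_inner (h s) (\<lambda>x. u s x - u t x) / (s - t) + l2_inner (h t) (\<lambda>x. u s x - u t x) / (s - t)
      = (l2_inner (h s) (u s) - l2_inner (h t) (u t)) / (s - t)"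
    using inJ
  proof eventually_elim
    case (elim s)
    show ?case
      using elim J sym[of s] by (simp add: l2_inner_diff_right hL u add_divide_distrib[symmetric])
  qed
  ultimately show ?thesis
    unfolding has_field_derivative_iff by (simp add: tendsto_cong)
qed

text \<open>The integrand is the product of \<open>nonlinearity \<alpha> f\<close> and
  \<open>f\<close>, which both lie in L^2.\<close>

lemma integrable_abs_powr:
  assumes "0 < \<alpha>" "f \<in> Lp 2" "f \<in> Lp (4 * \<alpha> + 2)"
  shows "integrable lborel (\<lambda>x. \<bar>f x\<bar> powr (2 * \<alpha> + 2))"
  using integrable_mult_Lp_2[OF nonlinearity_in_Lp_2[OF assms(1,3)] assms(2)]
  by (simp add: nonlinearity_mult_self assms(1))

text \<open>The tangent bound, used once at \<open>u t\<close> and once at \<open>u s\<close>,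
  encloses the increment of the integral between pairings of \<open>u s - u t\<close> with
  \<open>N t\<close> and with \<open>N s\<close>. After division the two bounds have the same limit,
  because the nonlinearity is continuous in time.\<close>

lemma integral_abs_powr_has_derivative:
  assumes \<alpha>: "0 < \<alpha>" and J: "t \<in> J"
    and u: "\<And>s. s \<in> J \<Longrightarrow> u s \<in> Lp 2" and cu: "lp_continuous_on (4 * \<alpha> + 2) J u"
    and f: "f \<in> Lp 2" and du: "l2_has_time_derivative u f t J"
  shows "((\<lambda>s. LINT x|lborel. \<bar>u s x\<bar> powr (2 * \<alpha> + 2)) has_real_derivative
    (2 * \<alpha> + 2) * l2_inner (nonlinearity \<alpha> (u t)) f) (at t within J)"
proof -
  define r where "r = 2 * \<alpha> + 2"
  define P where "P s = (LINT x|lborel. \<bar>u s x\<bar> powr r)" for s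
  define N where "N s = nonlinearity \<alpha> (u s)" for s
  let ?F = "at t within J"
  have r: "0 \<le> r" using \<alpha> by (simp add: r_def)
  have cN: "lp_continuous_on 2 J N"
    using nonlinearity_continuous[OF \<alpha> cu] by (simp add: N_def[abs_def])
  have NL: "N s \<in> Lp 2" if "s \<in> J" for s
    using cN that by (simp add: lp_continuous_on_def)
  have int: "integrable lborel (\<lambda>x. \<bar>u s x\<bar> powr r)" if "s \<in> J" for s
    using integrable_abs_powr[OF \<alpha> u[OF that]] cu that by (simp add: lp_continuous_on_def r_def)
  have tangent: "P a - P b \<le> r * l2_inner (N a) (\<lambda>x. u a x - u b x)"
    if "a \<in> J" "b \<in> J" for a b
  proof -
    have "P a - P b = (LINT x|lborel. \<bar>u a x\<bar> powr r - \<bar>u b x\<bar> powr r)"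
      using that by (simp add: P_def int)
    also have "\<dots> \<le> (LINT x|lborel. r * (N a x * (u a x - u b x)))"
    proof (rule integral_mono)
      show "integrable lborel (\<lambda>x. r * (N a x * (u a x - u b x)))"
        using integrable_mult_Lp_2[OF NL[OF that(1)] Lp_2_diff[OF u[OF that(1)] u[OF that(2)]]]
        by simp
      show "\<bar>u a x\<bar> powr r - \<bar>u b x\<bar> powr r \<le> r * (N a x * (u a x - u b x))" for x
        using abs_powr_tangent_bound[OF \<alpha>] by (simp add: r_def N_def)
    qed (use that int in simp)
    finally show ?thesis by (simp add: l2_inner_def)
  qed
  let ?A = "\<lambda>s. r * (l2_inner (N t) (\<lambda>x. u s x - u t x) / (s - t))"
  let ?B = "\<lambda>s. r * (l2_inner (N s) (\<lambda>x. u s x - u t x) / (s - t))"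
  have A: "(?A \<longlongrightarrow> r * l2_inner (N t) f) ?F"
    by (intro tendsto_mult tendsto_const
        l2_has_time_derivative_inner_left[OF J u f du, of "\<lambda>_. N t", simplified])
      (simp_all add: NL J lp_norm_def)
  have B: "(?B \<longlongrightarrow> r * l2_inner (N t) f) ?F"
    by (intro tendsto_mult tendsto_const l2_has_time_derivative_inner_left[OF J u f du NL])
      (use cN J in \<open>auto simp: lp_continuous_on_def\<close>)
  have BA: "((\<lambda>s. \<bar>?B s - ?A s\<bar>) \<longlongrightarrow> 0) ?F"
    using tendsto_rabs[OF tendsto_diff[OF B A]] by simp
  have inJ: "\<forall>\<^sub>F s in ?F. s \<in> J" by (simp add: eventually_at_filter)
  have "((\<lambda>s. (P s - P t) / (s - t) - ?A s) \<longlongrightarrow> 0) ?F"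
  proof (rule Lim_null_comparison[OF _ BA])
    show "\<forall>\<^sub>F s in ?F. norm ((P s - P t) / (s - t) - ?A s) \<le> \<bar>?B s - ?A s\<bar>"
      using inJ
    proof eventually_elim
      case (elim s)
      \<comment> \<open>From a \<le> P s - P t \<le> b the increment is within |b - a| of
        \<open>a\<close>. Dividing absolute values by |s - t| treats both signs of s - t
        together.\<close>
      define a b where "a = r * l2_inner (N t) (\<lambda>x. u s x - u t x)"
        and "b = r * l2_inner (N s) (\<lambda>x. u s x - u t x)"
      have "P s - P t \<le> b" using tangent[OF elim J] by (simp add: b_def)
      moreover have "a \<le> P s - P t"
        using tangent[OF J elim] elim J by (simp add: a_def l2_inner_diff_right NL u algebra_simps)
      ultimately have "\<bar>P s - P t - a\<bar> / \<bar>s - t\<bar> \<le> \<bar>b - a\<bar> / \<bar>s - t\<bar>"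
        by (intro divide_right_mono) auto
      then show ?case
        by (simp add: a_def b_def abs_divide[symmetric] diff_divide_distrib)
    qed
  qed
  from tendsto_add[OF this A]
  have "((\<lambda>s. (P s - P t) / (s - t)) \<longlongrightarrow> r * l2_inner (N t) f) ?F" by simp
  then show ?thesis
    unfolding has_field_derivative_iff P_def N_def r_def .
qed

section \<open>Scalar differential equations and monotonicity\<close>

lemma linear_ode_zero:
  fixes y m :: "real \<Rightarrow> real"
  assumes m: "continuous_on {a..b} m"
    and y: "\<And>t. t \<in> {a..b} \<Longrightarrow> (y has_real_derivative m t * y t) (at t within {a..b})"
    and "y a = 0" "t \<in> {a..b}"
  shows "y t = 0"
proof -
  obtain M where M: "\<And>t. t \<in> {a..b} \<Longrightarrow> (M has_real_derivative m t) (at t within {a..b})"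
    using antiderivative_continuous[OF m] unfolding has_real_derivative_iff_has_vector_derivative
    by blast
  \<comment> \<open>An antiderivative of \<open>m\<close> supplies the integrating factor: the
    product has derivative m y - y m = 0, so it keeps its initial value 0.\<close>
  have "((\<lambda>t. y t * exp (- M t)) has_real_derivative 0) (at s within {a..b})"
    if "s \<in> {a..b}" for s
    by (rule derivative_eq_intros y[OF that] M[OF that] refl)+ (simp add: algebra_simps)
  then obtain c where "\<forall>s\<in>{a..b}. y s * exp (- M s) = c"
    using has_field_derivative_zero_constant[of "{a..b}" "\<lambda>t. y t * exp (- M t)"] by auto
  moreover have "a \<in> {a..b}" using assms(4) by simp
  ultimately have "y t * exp (- M t) = y a * exp (- M a)" using assms(4) by metis
  then show ?thesis using assms(3) by simp
qed

text \<open>The mean value theorem on [s, t] reduces this to the sign of one derivative. Derivatives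
  within the whole interval restrict to [s, t], so one-sided ones at the endpoints are
  enough.\<close>

lemma nonincreasing_if_derivative_nonpos:
  fixes y :: "real \<Rightarrow> real"
  assumes y: "\<And>t. t \<in> {a..b} \<Longrightarrow> \<exists>D\<le>0. (y has_real_derivative D) (at t within {a..b})"
    and "a \<le> s" "s \<le> t" "t \<le> b"
  shows "y t \<le> y s"
proof -
  obtain D where D: "\<And>t. t \<in> {a..b} \<Longrightarrow> D t \<le> 0 \<and> (y has_real_derivative D t) (at t within {a..b})"
    using y by metis
  have "(y has_derivative (*) (D r)) (at r within {s..t})" if "s \<le> r" "r \<le> t" for r
    using D[of r] that assms(2-)
    by (auto simp: has_field_derivative_def intro: has_derivative_subset)
  from mvt_very_simple[OF \<open>s \<le> t\<close> this]
  obtain r where "r \<in> {s..t}" "y t - y s = D r * (t - s)" by auto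
  then show ?thesis
    using D[of r] assms(2-) mult_nonpos_nonneg[of "D r" "t - s"] by auto
qed

section \<open>The Nehari functional along the flow\<close>

text \<open>The flow attains its initial datum only almost everywhere, so the constraint has to be
  transferred between representatives.\<close>

lemma nehari_cong_AE:
  assumes f: "f \<in> borel_measurable lborel" and g: "g \<in> borel_measurable lborel"
    and V: "regular_potential V" and eq: "AE x in lborel. f x = g x"
  shows "nehari \<alpha> \<omega> V f = nehari \<alpha> \<omega> V g"
proof -
  \<comment> \<open>The predicates defining the gradient agree for \<open>f\<close> and
    \<open>g\<close>, hence the choice operator picks the same function for both;
    \<open>cont_rep\<close> is treated likewise.\<close>
  have "has_L2_weak_gradient f G = has_L2_weak_gradient g G" for G
  proof -
    have "(LINT x|lborel. f x * frechet_derivative \<eta> (at x) i)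
        = (LINT x|lborel. g x * frechet_derivative \<eta> (at x) i)"
      if "\<eta> \<in> test_functions" "i \<in> Basis" for \<eta> i
    proof (rule integral_cong_AE)
      \<comment> \<open>One order of smoothness makes the partial derivatives continuous, hence
        measurable, as the congruence of integrals requires.\<close>
      have "times_cont_diff (Suc 0) \<eta>" using that(1) unfolding test_functions_def by blast
      then have "continuous_on UNIV (\<lambda>x. frechet_derivative \<eta> (at x) i)"
        using that(2) by simp
      then have [measurable]: "(\<lambda>x. frechet_derivative \<eta> (at x) i) \<in> borel_measurable borel"
        by (rule borel_measurable_continuous_onI)
      show "(\<lambda>x. f x * frechet_derivative \<eta> (at x) i) \<in> borel_measurable lborel"
        "(\<lambda>x. g x * frechet_derivative \<eta> (at x) i) \<in> borel_measurable lborel"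
        using f g by simp_all
    qed (use eq in auto)
    then show ?thesis by (auto simp: has_L2_weak_gradient_def)
  qed
  then have "weak_gradient f = weak_gradient g" by (simp add: weak_gradient_def)
  moreover have "cont_rep f = cont_rep g"
  proof -
    have "(AE x in lborel. k x = f x) \<longleftrightarrow> (AE x in lborel. k x = g x)" for k
      using eq by (auto elim: AE_mp)
    then show ?thesis by (simp add: cont_rep_def)
  qed
  then have "potential_form V f f = potential_form V g g"
  proof (cases V)
    case (Function_potential v)
    then have "v \<in> borel_measurable lborel" using V by simp
    then show ?thesis
      using f g eq Function_potential by (auto intro!: integral_cong_AE)
  next
    case (Measure_potential m n w)
    then have "w \<in> borel_measurable lborel" using V by (simp add: Linf_def)
    then have "(LINT x|lborel. w x * f x * f x) = (LINT x|lborel. w x * g x * g x)"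
      using f g eq by (auto intro!: integral_cong_AE)
    then show ?thesis using Measure_potential \<open>cont_rep f = cont_rep g\<close> by simp
  qed
  moreover have "(LINT x|lborel. \<bar>f x\<bar>\<^sup>2) = (LINT x|lborel. \<bar>g x\<bar>\<^sup>2)"
    "(LINT x|lborel. \<bar>f x\<bar> powr (2 * \<alpha> + 2)) = (LINT x|lborel. \<bar>g x\<bar> powr (2 * \<alpha> + 2))"
    using f g eq by (auto intro!: integral_cong_AE)
  ultimately show ?thesis by (simp add: nehari_def)
qed

section \<open>The Schroedinger operator as a symmetric form\<close>

lemma schroedinger_form_commute: "schroedinger_form \<omega> V f g = schroedinger_form \<omega> V g f"
proof -
  have "potential_form V f g = potential_form V g f"
    by (cases V) (simp_all add: mult.assoc mult.commute mult.left_commute)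
  then show ?thesis by (simp add: schroedinger_form_def inner_commute mult.commute)
qed

lemma represents_schroedinger_op:
  assumes "f \<in> schroedinger_domain \<omega> V"
  shows "represents_schroedinger \<omega> V f (schroedinger_op \<omega> V f)"
  using assms unfolding schroedinger_domain_def schroedinger_op_def
  by (metis (mono_tags, lifting) mem_Collect_eq someI_ex)

text \<open>Elements of the operator domain lie in \<open>H1\<close>, so each can serve as the test
  function for the other.\<close>

lemma schroedinger_op_symmetric:
  assumes "f \<in> schroedinger_domain \<omega> V" "g \<in> schroedinger_domain \<omega> V"
  shows "l2_inner (schroedinger_op \<omega> V f) g = l2_inner (schroedinger_op \<omega> V g) f"
proof -
  have "l2_inner (schroedinger_op \<omega> V f) g = schroedinger_form \<omega> V f g"
    using represents_schroedinger_op[OF assms(1)] assms(2)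
    by (simp add: represents_schroedinger_def schroedinger_domain_def)
  also have "\<dots> = schroedinger_form \<omega> V g f" by (rule schroedinger_form_commute)
  also have "\<dots> = l2_inner (schroedinger_op \<omega> V g) f"
    using represents_schroedinger_op[OF assms(2)] assms(1)
    by (simp add: represents_schroedinger_def schroedinger_domain_def)
  finally show ?thesis .
qed

lemma energy_eq_l2_inner:
  assumes "f \<in> schroedinger_domain \<omega> V"
  shows "(LINT x|lborel. (norm (weak_gradient f x))\<^sup>2) + potential_form V f f +
     \<omega> * (LINT x|lborel. \<bar>f x\<bar>\<^sup>2) = l2_inner (schroedinger_op \<omega> V f) f"
proof -
  have "(norm (weak_gradient f x))\<^sup>2 = weak_gradient f x \<bullet> weak_gradient f x"
    "\<bar>f x\<bar>\<^sup>2 = f x * f x" for x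
    by (simp add: power2_norm_eq_inner) (simp add: power2_eq_square)
  then show ?thesis
    using represents_schroedinger_op[OF assms] assms
    by (simp add: represents_schroedinger_def schroedinger_domain_def schroedinger_form_def)
qed

theorem mainTheorem1:
  fixes V :: "('a::euclidean_space) potential"
    and \<alpha> \<omega> T :: real
    and \<phi>0 :: "'a \<Rightarrow> real"
    and \<phi> :: "real \<Rightarrow> 'a \<Rightarrow> real"
  assumes "0 < \<alpha>"
    and "DIM('a) > 2 \<longrightarrow> \<alpha> < 2 / (real DIM('a) - 2)"
    and "regular_potential V"
    and "nonpositive_potential V"
    and "\<omega> > omega0 V" and "omega0 V \<ge> 0"
    and "\<phi>0 \<in> nehari_manifold \<alpha> \<omega> V"
    and "0 \<le> T"
    and "gradient_flow_solution \<alpha> \<omega> V T \<phi>"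
    and "AE x in lborel. \<phi> 0 x = \<phi>0 x"
  shows "(\<forall>t\<in>{0..T}. nehari \<alpha> \<omega> V (\<phi> t) = 0) \<and>
         (\<forall>t t'. 0 \<le> t \<and> t \<le> t' \<and> t' \<le> T \<longrightarrow>
            action \<alpha> \<omega> V (\<phi> t') \<le> action \<alpha> \<omega> V (\<phi> t))"
proof -
  note \<alpha> = assms(1)
  let ?J = "{0..T}"
  define h where "h t = schroedinger_op \<omega> V (\<phi> t)" for t
  define N where "N t = nonlinearity \<alpha> (\<phi> t)" for t
  define \<mu> where "\<mu> t = flow_multiplier \<alpha> \<omega> V (\<phi> t)" for t
  define \<phi>' where "\<phi>' t = (\<lambda>x. - h t x + N t x + \<mu> t * \<phi> t x)" for t
  define E where "E t = l2_inner (h t) (\<phi> t)" for t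
  define P where "P t = (LINT x|lborel. \<bar>\<phi> t x\<bar> powr (2 * \<alpha> + 2))" for t
  have dom: "\<phi> t \<in> schroedinger_domain \<omega> V" and nz: "\<not> (AE x in lborel. \<phi> t x = 0)"
    if "t \<in> ?J" for t
    using assms(9) that by (auto simp: gradient_flow_solution_def)
  have ch: "lp_continuous_on 2 ?J h" and c\<phi>: "lp_continuous_on (4 * \<alpha> + 2) ?J \<phi>"
    using assms(9) by (auto simp: gradient_flow_solution_def h_def[abs_def])
  have d\<phi>: "l2_has_time_derivative \<phi> (\<phi>' t) t ?J" if "t \<in> ?J" for t
    using assms(9) that by (simp add: gradient_flow_solution_def \<phi>'_def h_def N_def \<mu>_def)
  have cN: "lp_continuous_on 2 ?J N"
    using nonlinearity_continuous[OF \<alpha> c\<phi>] by (simp add: N_def[abs_def])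
  have \<phi>L: "\<phi> t \<in> Lp 2" and hL: "h t \<in> Lp 2" and NL: "N t \<in> Lp 2" if "t \<in> ?J" for t
    using dom[OF that] ch cN that
    by (auto simp: schroedinger_domain_def H1_def lp_continuous_on_def)
  have \<phi>'_eq: "\<phi>' t = (\<lambda>x. (N t x - h t x) + \<mu> t * \<phi> t x)" for t
    by (simp add: \<phi>'_def)
  have \<phi>'L: "\<phi>' t \<in> Lp 2" if "t \<in> ?J" for t
    unfolding \<phi>'_eq by (intro Lp_2_add Lp_2_diff Lp_2_cmult NL hL \<phi>L that)

  \<comment> \<open>Derivatives of \<open>E\<close> and \<open>P\<close>, and continuity of the
    multiplier\<close>
  have dE: "(E has_real_derivative 2 * l2_inner (h t) (\<phi>' t)) (at t within ?J)"
    if "t \<in> ?J" for t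
    unfolding E_def[abs_def]
    using symmetric_form_has_derivative[OF that \<phi>L \<phi>'L[OF that] d\<phi>[OF that] ch]
      schroedinger_op_symmetric[OF dom dom[OF that]] by (simp add: h_def)
  have dP: "(P has_real_derivative (2 * \<alpha> + 2) * l2_inner (N t) (\<phi>' t)) (at t within ?J)"
    if "t \<in> ?J" for t
    unfolding P_def[abs_def] N_def
    using integral_abs_powr_has_derivative[OF \<alpha> that \<phi>L c\<phi> \<phi>'L[OF that] d\<phi>[OF that]] .
  have inner_cont: "continuous_on ?J (\<lambda>t. l2_inner (f t) (g t))"
    if "lp_continuous_on 2 ?J f" "lp_continuous_on 2 ?J g" for f g :: "real \<Rightarrow> 'a \<Rightarrow> real"
    unfolding continuous_on_def
  proof
    fix t assume t: "t \<in> ?J"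
    have inJ: "\<forall>\<^sub>F s in at t within ?J. s \<in> ?J" by (simp add: eventually_at_filter)
    show "((\<lambda>t. l2_inner (f t) (g t)) \<longlongrightarrow> l2_inner (f t) (g t)) (at t within ?J)"
      by (rule l2_inner_tendsto)
        (use that t inJ in \<open>auto simp: lp_continuous_on_def elim: eventually_mono\<close>)
  qed

  \<comment> \<open>A nonnegative integrand with integral 0 vanishes almost everywhere, which
    \<open>nz\<close> excludes; the denominator of the multiplier is therefore positive.\<close>
  have P_pos: "0 < P t" if "t \<in> ?J" for t
  proof -
    have "integrable lborel (\<lambda>x. \<bar>\<phi> t x\<bar> powr (2 * \<alpha> + 2))"
      using integrable_abs_powr[OF \<alpha> \<phi>L[OF that]] c\<phi> that by (simp add: lp_continuous_on_def)
    then have "P t \<noteq> 0"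
      using nz[OF that] unfolding P_def by (subst integral_nonneg_eq_0_iff_AE) auto
    moreover have "0 \<le> P t" by (simp add: P_def)
    ultimately show ?thesis by simp
  qed
  have \<mu>_eq: "\<mu> t = - (l2_inner (h t) (h t) - (\<alpha> + 2) * l2_inner (h t) (N t)
      + (\<alpha> + 1) * l2_inner (N t) (N t)) / (\<alpha> * P t)" for t
  proof -
    have "l2_inner (N t) (N t) = (LINT x|lborel. \<bar>\<phi> t x\<bar> powr (4 * \<alpha> + 2))"
      using nonlinearity_power2[OF \<alpha>, of "\<phi> t"] by (simp add: l2_inner_def N_def power2_eq_square)
    then show ?thesis
      using \<alpha> by (simp add: \<mu>_def flow_multiplier_def lp_norm_powr lp_norm_2_power2
          h_def N_def P_def)
  qed
  have c\<mu>: "continuous_on ?J \<mu>"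
  proof -
    have "continuous_on ?J P"
      by (rule DERIV_continuous_on[OF dP])
    moreover have "\<alpha> * P t \<noteq> 0" if "t \<in> ?J" for t
      using \<alpha> P_pos[OF that] by simp
    ultimately show ?thesis
      unfolding \<mu>_eq[abs_def] by (intro continuous_intros inner_cont ch cN ballI)
  qed

  \<comment> \<open>The functionals and the flow expressed through inner products\<close>
  have nehari_eq: "nehari \<alpha> \<omega> V (\<phi> t) = E t - P t" if "t \<in> ?J" for t
    using energy_eq_l2_inner[OF dom[OF that]] by (simp add: nehari_def E_def P_def h_def)
  have action_eq: "action \<alpha> \<omega> V (\<phi> t) = E t - 1 / (\<alpha> + 1) * P t" if "t \<in> ?J" for t
    using energy_eq_l2_inner[OF dom[OF that]] by (simp add: action_def E_def P_def h_def)
  have NP: "l2_inner (N t) (\<phi> t) = P t" for t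
    by (simp add: l2_inner_def N_def nonlinearity_mult_self \<alpha> P_def)
  have h\<phi>': "l2_inner (h t) (\<phi>' t) = l2_inner (h t) (N t) - l2_inner (h t) (h t) + \<mu> t * E t"
    if "t \<in> ?J" for t
    unfolding \<phi>'_eq
    using that by (simp add: l2_inner_add_right l2_inner_diff_right l2_inner_cmult_right
        Lp_2_diff Lp_2_cmult hL NL \<phi>L E_def)
  have N\<phi>': "l2_inner (N t) (\<phi>' t) = l2_inner (N t) (N t) - l2_inner (h t) (N t) + \<mu> t * P t"
    if "t \<in> ?J" for t
    unfolding \<phi>'_eq
    using that by (simp add: l2_inner_add_right l2_inner_diff_right l2_inner_cmult_right
        Lp_2_diff Lp_2_cmult hL NL \<phi>L NP l2_inner_commute[of "N t" "h t"])

  \<comment> \<open>Conservation of the Nehari constraint\<close>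
  have EP: "E t - P t = 0" if t: "t \<in> ?J" for t
  proof (rule linear_ode_zero[where y = "\<lambda>t. E t - P t" and m = "\<lambda>t. 2 * \<mu> t", OF _ _ _ t])
    show "continuous_on ?J (\<lambda>t. 2 * \<mu> t)" by (intro continuous_intros c\<mu>)
    show "((\<lambda>t. E t - P t) has_real_derivative 2 * \<mu> s * (E s - P s)) (at s within ?J)"
      if "s \<in> ?J" for s
    proof -
      \<comment> \<open>The terms free of \<open>\<mu>\<close> in 2<h, \<phi>'> - (2\<alpha> + 2)<N,
        \<phi>'> are twice this right-hand side, hence equal 2\<mu>\<alpha>P. Together with 2\<mu>E
        - (2\<alpha> + 2)\<mu>P they sum to 2\<mu>(E - P).\<close>
      have "\<mu> s * (\<alpha> * P s) = - (l2_inner (h s) (h s) - (\<alpha> + 2) * l2_inner (h s) (N s)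
          + (\<alpha> + 1) * l2_inner (N s) (N s))"
        using \<mu>_eq[of s] \<alpha> P_pos[OF that] by simp
      then have "2 * l2_inner (h s) (\<phi>' s) - (2 * \<alpha> + 2) * l2_inner (N s) (\<phi>' s)
          = 2 * \<mu> s * (E s - P s)"
        unfolding h\<phi>'[OF that] N\<phi>'[OF that] by (simp add: algebra_simps)
      then show ?thesis using DERIV_diff[OF dE[OF that] dP[OF that]] by simp
    qed
    have "nehari \<alpha> \<omega> V (\<phi> 0) = nehari \<alpha> \<omega> V \<phi>0"
      using assms(7) \<phi>L[of 0] assms(8)
      by (intro nehari_cong_AE assms(3,10)) (auto simp: nehari_manifold_def H1_def Lp_def)
    then show "E 0 - P 0 = 0"
      using nehari_eq[of 0] assms(7,8) by (simp add: nehari_manifold_def)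
  qed

  \<comment> \<open>Decay of the action\<close>
  have dS: "((\<lambda>t. E t - 1 / (\<alpha> + 1) * P t) has_real_derivative
      - 2 * l2_inner (\<lambda>x. h t x - N t x) (\<lambda>x. h t x - N t x)) (at t within ?J)"
    if "t \<in> ?J" for t
  proof -
    \<comment> \<open>The weight 1/(\<alpha> + 1) turns the factor 2\<alpha> + 2 into 2, leaving 2<h
      - N, \<phi>'>. Since \<phi>' = -(h - N) + \<mu>\<phi>, the multiplier contributes 2\<mu>(E -
      P), which is 0 by \<open>EP\<close>.\<close>
    have "2 * l2_inner (h t) (\<phi>' t)
        - 1 / (\<alpha> + 1) * ((2 * \<alpha> + 2) * l2_inner (N t) (\<phi>' t))
        = 2 * (l2_inner (h t) (\<phi>' t) - l2_inner (N t) (\<phi>' t))"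
      using \<alpha> by (simp add: field_simps)
    also have "\<dots> = - 2 * l2_inner (\<lambda>x. h t x - N t x) (\<lambda>x. h t x - N t x)"
      unfolding h\<phi>'[OF that] N\<phi>'[OF that] using EP[OF that] that
      by (simp add: l2_inner_diff_left l2_inner_diff_right Lp_2_diff hL NL
          l2_inner_commute[of "N t" "h t"])
    finally show ?thesis
      using DERIV_diff[OF dE[OF that] DERIV_cmult[OF dP[OF that], of "1 / (\<alpha> + 1)"]] by simp
  qed
  have "E t' - 1 / (\<alpha> + 1) * P t' \<le> E t - 1 / (\<alpha> + 1) * P t"
    if "0 \<le> t" "t \<le> t'" "t' \<le> T" for t t'
  proof (rule nonincreasing_if_derivative_nonpos[OF _ that])
    show "\<exists>D\<le>0. ((\<lambda>t. E t - 1 / (\<alpha> + 1) * P t) has_real_derivative D) (at s within ?J)"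
      if "s \<in> ?J" for s
      using dS[OF that] l2_inner_self_nonneg[of "\<lambda>x. h s x - N s x"]
      by (intro exI[of _ "- 2 * l2_inner (\<lambda>x. h s x - N s x) (\<lambda>x. h s x - N s x)"]) simp
  qed
  then show ?thesis
    using nehari_eq action_eq EP by simp
qed

end
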